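(* Let $T$ be a tree of order at least $3$. Then $0<\frac{\gamma_t(T)}{\gamma_{sp}(T)}\leq \frac{4}{3}$. Moreover, a tree $T$ of order at least $3$ satisfies $\frac{\gamma_t(T)}{\gamma_{sp}(T)}=\frac{4}{3}$ if and only if there is a labeling $S$ of $T$ such that $(T,S)\in\mathscr{T}$.
   Context: $\gamma_t(G)$ is the total domination number of $G$ (minimum size of a set $D$ such that every vertex of $G$ has a neighbor in $D$). For $S\subseteq V(G)$, $\overline{S}=V(G)\setminus S$. A set $S\subseteq V(G)$ is a super dominating set if for every $u\in\overline{S}$ there exists $v\in S$ with $N(v)\cap\overline{S}=\{u\}$, where $N(v)$ is the open neighborhood of $v$; $\gamma_{sp}(G)$ is the minimum cardinality of a super dominating set. A labeling of a tree $T$ is a weak partition $S=(S_A,S_B,S_C)$ of $V(T)$ (some parts may be empty); the status of $v$ is the letter $x\in\{A,B,C\}$ with $v\in S_x$, and $(T,S)$ is a labeled tree. The family $\mathscr{T}$ of labeled trees is the smallest family that (i) contains $(P_6,S_0)$, where $S_0$ gives the two leaves of the path $P_6$ status $C$, the two support vertices status $A$, and the two remaining (central) vertices status $B$; and (ii) is closed under the operation $\mathscr{O}$: given $(T',S')\in\mathscr{T}$ and a vertex $v$ of $T'$ with status $B$, add a new path $u_1u_2u_3u_4u_5u_6$ and the edge $u_3v$, keep all old statuses, and give $u_1,u_6$ status $C$, $u_2,u_5$ status $A$, and $u_3,u_4$ status $B$. *)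

theory Defs
  imports Complex_Main "Graph_Theory.Graph_Theory"
begin

text \<open>
  A finite simple graph is a \<^locale>\<open>pair_graph\<close>: finite, loop-free, and with a symmetric set of
  arcs, each undirected edge being represented by its two arcs.

  The constant \<^const>\<open>tree\<close> is unsuitable for such graphs, because \<^const>\<open>pre_digraph.cycle\<close>
  counts the closed walk that traverses one edge back and forth as a cycle, so that no symmetric
  digraph with an edge is a \<^const>\<open>forest\<close>. In a simple graph the undirected cycles are exactly
  the directed cycles of length at least 3.
\<close>

definition undirected_tree :: "'a pair_pre_digraph \<Rightarrow> bool" where
  "undirected_tree T \<longleftrightarrow>
     pair_graph T \<and> Digraph_Component.connected (with_proj T) \<and>
     \<not> (\<exists>p. pre_digraph.cycle (with_proj T) p \<and> 3 \<le> length p)"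

definition open_neighborhood :: "'a pair_pre_digraph \<Rightarrow> 'a \<Rightarrow> 'a set" where
  "open_neighborhood G v = {u \<in> pverts G. (v, u) \<in> parcs G}"

definition total_dominating_set :: "'a pair_pre_digraph \<Rightarrow> 'a set \<Rightarrow> bool" where
  "total_dominating_set G D \<longleftrightarrow>
     D \<subseteq> pverts G \<and> (\<forall>v \<in> pverts G. open_neighborhood G v \<inter> D \<noteq> {})"

text \<open>A finite graph has a total dominating set iff it has no isolated vertex; only then is the
  following number meaningful.\<close>

definition total_domination_number :: "'a pair_pre_digraph \<Rightarrow> nat" where
  "total_domination_number G = (LEAST k. \<exists>D. total_dominating_set G D \<and> card D = k)"

definition super_dominating_set :: "'a pair_pre_digraph \<Rightarrow> 'a set \<Rightarrow> bool" where
  "super_dominating_set G S \<longleftrightarrow>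
     S \<subseteq> pverts G \<and>
     (\<forall>u \<in> pverts G - S. \<exists>v \<in> S. open_neighborhood G v \<inter> (pverts G - S) = {u})"

definition super_domination_number :: "'a pair_pre_digraph \<Rightarrow> nat" where
  "super_domination_number G = (LEAST k. \<exists>S. super_dominating_set G S \<and> card S = k)"

text \<open>A labeling is the triple of the sets of vertices of status A, B and C, in that order.\<close>

type_synonym 'a labeling = "'a set \<times> 'a set \<times> 'a set"

definition is_labeling :: "'a pair_pre_digraph \<Rightarrow> 'a labeling \<Rightarrow> bool" where
  "is_labeling T S \<longleftrightarrow>
     (case S of (SA, SB, SC) \<Rightarrow>
        SA \<union> SB \<union> SC = pverts T \<and> SA \<inter> SB = {} \<and> SA \<inter> SC = {} \<and> SB \<inter> SC = {})"

definition path_graph :: "'a list \<Rightarrow> 'a pair_pre_digraph" where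
  "path_graph us =
     \<lparr> pverts = set us, parcs = set (vwalk_arcs us) \<union> (set (vwalk_arcs us))\<inverse> \<rparr>"

text \<open>Graphs are taken up to isomorphism, so the path on six vertices and the paths that are added
  may use arbitrary distinct vertices, in the second case fresh ones.\<close>

inductive_set labeled_tree_family :: "('a pair_pre_digraph \<times> 'a labeling) set" where
  path6:
    "distinct [u1, u2, u3, u4, u5, u6] \<Longrightarrow>
     (path_graph [u1, u2, u3, u4, u5, u6], ({u2, u5}, {u3, u4}, {u1, u6}))
       \<in> labeled_tree_family"
| attach:
    "\<lbrakk>(T, (SA, SB, SC)) \<in> labeled_tree_family; v \<in> SB;
      distinct [u1, u2, u3, u4, u5, u6]; {u1, u2, u3, u4, u5, u6} \<inter> pverts T = {}\<rbrakk> \<Longrightarrow>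
     (\<lparr> pverts = pverts T \<union> {u1, u2, u3, u4, u5, u6},
        parcs = parcs T \<union> parcs (path_graph [u1, u2, u3, u4, u5, u6]) \<union> {(u3, v), (v, u3)} \<rparr>,
      (SA \<union> {u2, u5}, SB \<union> {u3, u4}, SC \<union> {u1, u6}))
       \<in> labeled_tree_family"

end

theory Submission
  imports Defs
begin

text \<open>
  Every super dominating set \<open>S\<close> satisfies \<open>|V| \<le> 2|S|\<close>, as the vertices outside \<open>S\<close> inject into \<open>S\<close>,
  and every tree on at least three vertices has a total dominating set of size at most \<open>2|V|/3\<close>:
  root it at distance two from a leaf and, for each of the three residues modulo 3, delete the
  levels of that residue and trade every leaf just below a deleted level for its parent. The three
  resulting sets together have at most \<open>2|V|\<close> elements.

  If the ratio is \<open>4/3\<close>, both bounds are tight. Then no vertex of the three level sets is redundant,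
  which forces every support vertex to have one leaf as its only child and every remaining vertex
  to have exactly one support vertex as a child. Tightness of the first bound yields a perfect
  matching, and it pairs up these remaining vertices. So the tree is made of 6-vertex paths, and
  it is built by attaching them from the root downwards. Conversely, both bounds are checked by
  induction along this construction.
\<close>

subsection \<open>Rooting a tree\<close>

text \<open>The parent function encodes the whole edge set, so once a root is fixed no walk or cycle
  is needed any more. \<open>par\<close> is unconstrained at the root, hence the guards
  \<open>x \<noteq> r\<close>.\<close>

locale rooted_tree =
  fixes T :: "'a pair_pre_digraph" and r :: 'a and par :: "'a \<Rightarrow> 'a" and lev :: "'a \<Rightarrow> nat"
  assumes finite_verts: "finite (pverts T)"
    and root: "r \<in> pverts T"
    and par_in: "\<lbrakk>x \<in> pverts T; x \<noteq> r\<rbrakk> \<Longrightarrow> par x \<in> pverts T"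
    and lev_root: "lev r = 0"
    and lev_par: "\<lbrakk>x \<in> pverts T; x \<noteq> r\<rbrakk> \<Longrightarrow> lev x = Suc (lev (par x))"
    and arcs_iff: "(x, y) \<in> parcs T \<longleftrightarrow>
      x \<in> pverts T \<and> x \<noteq> r \<and> y = par x \<or> y \<in> pverts T \<and> y \<noteq> r \<and> x = par y"

text \<open>Shortening the walk to a path keeps it away from \<open>u\<close>. As
  \<open>y \<noteq> z\<close> the path has an arc, and the two arcs at \<open>u\<close> close it to
  a cycle with at least three arcs, so back-and-forth traversals of one edge are excluded.\<close>

lemma (in pair_graph) extend_to_cycle:
  assumes "awalk y q z" "u \<notin> set (awalk_verts y q)" "y \<noteq> z" "(u, y) \<in> parcs G" "(z, u) \<in> parcs G"
  shows "\<exists>p. cycle p \<and> 3 \<le> length p"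
proof -
  define p where "p = awalk_to_apath q"
  have ap: "apath y p z" using apath_awalk_to_apath[OF assms(1)] by (simp add: p_def)
  have sub: "set (awalk_verts y p) \<subseteq> set (awalk_verts y q)"
    using awalk_to_apath_subset[OF assms(1)] set_awalk_verts[OF assms(1)]
      set_awalk_verts[of y p z] ap by (auto simp: p_def apath_def)
  have aw: "awalk y p z" and dist: "distinct (awalk_verts y p)" using ap by (auto simp: apath_def)
  have ne: "p \<noteq> []" using aw assms(3) by (auto simp: awalk_Nil_iff)
  let ?c = "(u, y) # p @ [(z, u)]"
  have uv: "u \<in> pverts G" "z \<in> pverts G" using assms by (auto dest: in_arcsD1 in_arcsD2)
  have aw2: "awalk y (p @ [(z, u)]) u"
    by (rule awalk_appendI[OF aw]) (simp add: awalk_simps assms uv)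
  have c: "awalk u ?c u" using aw2 assms(4) uv by (simp only: awalk_Cons_iff) auto
  have "awalk_verts y (p @ [(z, u)]) = awalk_verts y p @ [u]"
    using awalk_verts_append[OF aw2] aw by simp
  hence "distinct (tl (awalk_verts u ?c))" using dist sub assms(2) by auto
  hence "cycle ?c" using c unfolding cycle_def by blast
  moreover have "3 \<le> length ?c" using ne by (cases p) auto
  ultimately show ?thesis by blast
qed

text \<open>A connected set grows from the root one vertex at a time. A new vertex adjacent to the
  set has only one neighbour in it, since a second one would close a cycle, and that neighbour
  becomes its parent.\<close>

lemma undirected_tree_rooting:
  assumes tree: "undirected_tree T" and r: "r \<in> pverts T"
  obtains par lev where "rooted_tree T r par lev"
proof -
  interpret G: pair_graph T using tree by (simp add: undirected_tree_def)
  have conn: "strongly_connected (with_proj T)"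
    using tree G.symmetric_connected_imp_strongly_connected G.sym_arcs
    by (auto simp: undirected_tree_def)
  have acyc: "\<not> (\<exists>p. G.cycle p \<and> 3 \<le> length p)" using tree by (simp add: undirected_tree_def)
  \<comment> \<open>The last conjunct asks for walks staying inside \<open>X\<close>: they avoid any
    vertex outside \<open>X\<close>, as \<open>extend_to_cycle\<close> requires.\<close>
  define ok where "ok X par lev \<longleftrightarrow> X \<subseteq> pverts T \<and> r \<in> X \<and> lev r = 0 \<and>
      (\<forall>x\<in>X. x \<noteq> r \<longrightarrow> par x \<in> X \<and> lev x = Suc (lev (par x))) \<and>
      (\<forall>x\<in>X. \<forall>y\<in>X. (x, y) \<in> parcs T \<longleftrightarrow> x \<noteq> r \<and> y = par x \<or> y \<noteq> r \<and> x = par y) \<and>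
      (\<forall>x\<in>X. \<forall>y\<in>X. \<exists>q. G.awalk x q y \<and> set (G.awalk_verts x q) \<subseteq> X)"
    for X and par :: "'a \<Rightarrow> 'a" and lev :: "'a \<Rightarrow> nat"
  have grow: "\<exists>X' par' lev'. ok X' par' lev' \<and> card X' = Suc (card X)"
    if ok: "ok X par lev" and neq: "X \<noteq> pverts T" for X par lev
  proof -
    from ok have X: "X \<subseteq> pverts T" "r \<in> X" and lr: "lev r = 0"
      and par: "\<And>x. x \<in> X \<Longrightarrow> x \<noteq> r \<Longrightarrow> par x \<in> X \<and> lev x = Suc (lev (par x))"
      and arcs: "\<And>x y. x \<in> X \<Longrightarrow> y \<in> X \<Longrightarrow>
         (x, y) \<in> parcs T \<longleftrightarrow> x \<noteq> r \<and> y = par x \<or> y \<noteq> r \<and> x = par y"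
      and walks: "\<And>x y. x \<in> X \<Longrightarrow> y \<in> X \<Longrightarrow> \<exists>q. G.awalk x q y \<and> set (G.awalk_verts x q) \<subseteq> X"
      unfolding ok_def by blast+
    have finX: "finite X" using X G.finite_verts finite_subset by blast
    have exit: "\<exists>p\<in>X. \<exists>u. u \<notin> X \<and> (p, u) \<in> parcs T" if "G.awalk x q y" "x \<in> X" "y \<notin> X" for x q y
      using that
    proof (induction q arbitrary: x)
      case Nil then show ?case by (auto simp: G.awalk_simps)
    next
      case (Cons e q)
      then show ?case by (cases e) (auto simp: G.awalk_simps)
    qed
    from neq X obtain w where w: "w \<in> pverts T" "w \<notin> X" by blast
    have "r \<rightarrow>\<^sup>*\<^bsub>with_proj T\<^esub> w" using conn r w by (auto simp: strongly_connected_def)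
    then obtain q where "G.awalk r q w" by (auto simp: G.reachable_awalk)
    from exit[OF this X(2) w(2)] obtain p u where pu: "p \<in> X" "u \<notin> X" "(p, u) \<in> parcs T" by blast
    have up: "(u, p) \<in> parcs T" using pu G.arcs_symmetric by blast
    have uV: "u \<in> pverts T" using up G.in_arcsD1 by blast
    have ur: "u \<noteq> r" using pu X by blast
    have uniq: "y = p" if y: "y \<in> X" "(u, y) \<in> parcs T" for y
    proof (rule ccontr)
      assume "y \<noteq> p"
      obtain q where "G.awalk y q p" "set (G.awalk_verts y q) \<subseteq> X" using walks y(1) pu(1) by blast
      thus False using G.extend_to_cycle[of y q p u] acyc y pu \<open>y \<noteq> p\<close> by blast
    qed
    let ?X = "insert u X" and ?par = "par(u := p)" and ?lev = "lev(u := Suc (lev p))"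
    have "ok ?X ?par ?lev" unfolding ok_def
    proof (intro conjI)
      show "?X \<subseteq> pverts T" using X uV by blast
      show "r \<in> ?X" using X by blast
      show "?lev r = 0" using lr ur by simp
      show "\<forall>x\<in>?X. x \<noteq> r \<longrightarrow> ?par x \<in> ?X \<and> ?lev x = Suc (?lev (?par x))"
        using par pu by auto
      show "\<forall>x\<in>?X. \<forall>y\<in>?X. ((x, y) \<in> parcs T) = (x \<noteq> r \<and> y = ?par x \<or> y \<noteq> r \<and> x = ?par y)"
      proof (intro ballI)
        fix x y assume xy: "x \<in> ?X" "y \<in> ?X"
        have nl: "(u, u) \<notin> parcs T" using G.no_loops' by blast
        consider "x = u" "y = u" | "x = u" "y \<in> X" | "x \<in> X" "y = u" | "x \<in> X" "y \<in> X"
          using xy by blast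
        thus "((x, y) \<in> parcs T) = (x \<noteq> r \<and> y = ?par x \<or> y \<noteq> r \<and> x = ?par y)"
        proof cases
          case 1 thus ?thesis using nl pu by auto
        next
          case 2
          hence "(u, y) \<in> parcs T \<longleftrightarrow> y = p" using uniq up by blast
          moreover have "y \<noteq> r \<Longrightarrow> u \<noteq> par y" "y \<noteq> u" using 2 par[of y] pu(2) by auto
          ultimately show ?thesis using 2 ur by auto
        next
          case 3
          hence "(x, u) \<in> parcs T \<longleftrightarrow> x = p" using uniq pu G.arcs_symmetric by blast
          moreover have "x \<noteq> r \<Longrightarrow> u \<noteq> par x" "x \<noteq> u" using 3 par[of x] pu(2) by auto
          ultimately show ?thesis using 3 ur by auto
        next
          case 4
          hence "x \<noteq> u" "y \<noteq> u" using pu(2) by auto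
          thus ?thesis using arcs[OF 4] by simp
        qed
      qed
      show "\<forall>x\<in>?X. \<forall>y\<in>?X. \<exists>q. G.awalk x q y \<and> set (G.awalk_verts x q) \<subseteq> ?X"
      proof (intro ballI)
        fix x y assume xy: "x \<in> ?X" "y \<in> ?X"
        consider "x = u" "y = u" | "x = u" "y \<in> X" | "x \<in> X" "y = u" | "x \<in> X" "y \<in> X"
          using xy by blast
        thus "\<exists>q. G.awalk x q y \<and> set (G.awalk_verts x q) \<subseteq> ?X"
        proof cases
          case 1 thus ?thesis using uV by (intro exI[of _ "[]"]) (auto simp: G.awalk_simps)
        next
          case 2
          then obtain q where "G.awalk p q y" "set (G.awalk_verts p q) \<subseteq> X" using walks pu by blast
          thus ?thesis using 2 up uV by (intro exI[of _ "(u, p) # q"]) (auto simp: G.awalk_simps)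
        next
          case 3
          then obtain q where q: "G.awalk x q p" "set (G.awalk_verts x q) \<subseteq> X" using walks pu by blast
          have "G.awalk p [(p, u)] u" using pu uV X by (auto simp: G.awalk_simps)
          hence aw: "G.awalk x (q @ [(p, u)]) u" using q(1) by (rule G.awalk_appendI[rotated])
          have "G.awalk_verts x (q @ [(p, u)]) = G.awalk_verts x q @ [u]"
            using G.awalk_verts_append[OF aw] q(1) by simp
          thus ?thesis using 3 aw q by (intro exI[of _ "q @ [(p, u)]"]) auto
        next
          case 4 thus ?thesis using walks by blast
        qed
      qed
    qed
    moreover have "card ?X = Suc (card X)" using finX pu by simp
    ultimately show ?thesis by blast
  qed
  have base: "ok {r} par (\<lambda>_. 0)" for par
    unfolding ok_def using r G.no_loops'
    by (auto intro!: exI[of _ "[]"] simp: G.awalk_simps)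
  have "\<exists>X par lev. ok X par lev \<and> card X = Suc n" if "Suc n \<le> card (pverts T)" for n
    using that
  proof (induction n)
    case 0 show ?case using base by (intro exI[of _ "{r}"]) auto
  next
    case (Suc n)
    then obtain X par lev where "ok X par lev" "card X = Suc n" by auto
    moreover from this Suc.prems have "X \<noteq> pverts T" by auto
    ultimately show ?case using grow by metis
  qed
  note grown = this
  have "card (pverts T) \<noteq> 0" using r G.finite_verts by auto
  then obtain m where m: "card (pverts T) = Suc m" using not0_implies_Suc by blast
  then obtain X par lev where ok: "ok X par lev" and "card X = card (pverts T)"
    using grown[of m] by auto
  hence X: "X = pverts T" using G.finite_verts unfolding ok_def by (simp add: card_subset_eq)
  have "rooted_tree T r par lev"
  proof
    fix x y
    show "(x, y) \<in> parcs T \<longleftrightarrow>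
      x \<in> pverts T \<and> x \<noteq> r \<and> y = par x \<or> y \<in> pverts T \<and> y \<noteq> r \<and> x = par y"
      using ok G.in_arcsD1[of x y] G.in_arcsD2[of x y] unfolding ok_def X by blast
  qed (use ok G.finite_verts r in \<open>auto simp: ok_def X\<close>)
  thus thesis by (rule that)
qed

subsection \<open>Total domination in a rooted tree\<close>

lemma total_domination_number_le:
  "total_dominating_set G D \<Longrightarrow> total_domination_number G \<le> card D"
  unfolding total_domination_number_def by (rule Least_le) blast

lemma total_domination_number_attained:
  assumes "total_dominating_set G D"
  obtains D' where "total_dominating_set G D'" "card D' = total_domination_number G"
  using LeastI[of "\<lambda>k. \<exists>D. total_dominating_set G D \<and> card D = k" "card D"] assms
  unfolding total_domination_number_def by blast

lemma super_domination_number_le: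
  "super_dominating_set G S \<Longrightarrow> super_domination_number G \<le> card S"
  unfolding super_domination_number_def by (rule Least_le) blast

lemma super_domination_number_attained:
  obtains S where "super_dominating_set G S" "card S = super_domination_number G"
proof -
  have "super_dominating_set G (pverts G)" by (simp add: super_dominating_set_def)
  thus thesis
    using LeastI[of "\<lambda>k. \<exists>S. super_dominating_set G S \<and> card S = k" "card (pverts G)"] that
    unfolding super_domination_number_def by blast
qed

context rooted_tree
begin

definition children :: "'a \<Rightarrow> 'a set" where
  "children x = {y \<in> pverts T. y \<noteq> r \<and> par y = x}"

definition leaves :: "'a set" where
  "leaves = {x \<in> pverts T. children x = {}}"

definition supports :: "'a set" where
  "supports = {x \<in> pverts T. children x \<inter> leaves \<noteq> {}}"

definition inner :: "'a set" where
  "inner = pverts T - leaves - supports"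

lemma children_iff: "y \<in> children x \<longleftrightarrow> y \<in> pverts T \<and> y \<noteq> r \<and> par y = x"
  by (auto simp: children_def)

lemma open_neighborhood_eq:
  assumes "x \<in> pverts T"
  shows "open_neighborhood T x = children x \<union> (if x = r then {} else {par x})"
  using assms par_in by (auto simp: open_neighborhood_def arcs_iff children_def)

lemma lev_child: "y \<in> children x \<Longrightarrow> lev y = Suc (lev x)"
  using lev_par by (auto simp: children_def)

lemma child_in: "y \<in> children x \<Longrightarrow> y \<in> pverts T \<and> x \<in> pverts T"
  using par_in by (auto simp: children_def)

lemma child_of_par: "\<lbrakk>x \<in> pverts T; x \<noteq> r\<rbrakk> \<Longrightarrow> x \<in> children (par x)"
  by (simp add: children_def)

lemma total_dominating_setI:
  assumes "D \<subseteq> pverts T"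
    and "\<And>x. x \<in> pverts T \<Longrightarrow> (\<exists>y\<in>children x. y \<in> D) \<or> x \<noteq> r \<and> par x \<in> D"
  shows "total_dominating_set T D"
  unfolding total_dominating_set_def using assms by (fastforce simp: open_neighborhood_eq)

text \<open>The shift \<open>k\<close> selects the residue class of levels to delete, so that the
  deleted class is always phase 0.\<close>

definition phase :: "nat \<Rightarrow> 'a \<Rightarrow> nat" where
  "phase k x = (lev x + k) mod 3"

lemma phase_child: "y \<in> children x \<Longrightarrow> phase k y = Suc (phase k x) mod 3"
  using lev_child by (auto simp: phase_def mod_Suc_eq)

lemma phase_less: "phase k x < 3"
  by (simp add: phase_def)

lemma phase_cases:
  obtains "phase k x = 0" | "phase k x = 1" | "phase k x = 2"
  using phase_less[of k x] by linarith

lemma phase_shift: obtains k where "phase k x = 2"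
proof
  have "lev x + (2 + 2 * lev x) = 2 + 3 * lev x" by simp
  thus "phase (2 + 2 * lev x) x = 2" unfolding phase_def by (metis mod_mult_self2 mod_less numeral_2_eq_2 lessI numeral_3_eq_3)
qed

definition level_set :: "nat \<Rightarrow> 'a set" where
  "level_set k = {x \<in> pverts T. phase k x = 0}"

text \<open>All vertices outside every third level, except that a leaf just below a deleted level is
  traded for its parent.\<close>

definition level_dom :: "nat \<Rightarrow> 'a set" where
  "level_dom k = {x \<in> pverts T. phase k x = 2} \<union> {x \<in> pverts T - leaves. phase k x = 1} \<union>
     {x \<in> supports. phase k x = 0}"

text \<open>Every support in phase 0 has a leaf child in phase 1, and those leaves are left out of
  \<open>level_dom k\<close>. So the supports added are at most as many as the leaves dropped, and
  these leaves, the rest of the set and the deleted level are disjoint.\<close>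

lemma card_level_dom: "card (level_dom k) + card (level_set k) \<le> card (pverts T)"
proof -
  define L where "L = {x \<in> leaves. phase k x = 1}"
  define P where "P = {x \<in> pverts T. phase k x = 2} \<union> {x \<in> pverts T - leaves. phase k x = 1}"
  have fin: "finite L" "finite P" "finite (level_set k)"
    using finite_verts by (auto simp: L_def P_def leaves_def level_set_def)
  have "{x \<in> supports. phase k x = 0} \<subseteq> par ` L"
  proof
    fix x assume "x \<in> {x \<in> supports. phase k x = 0}"
    then obtain y where "y \<in> children x" "y \<in> leaves" "phase k x = 0" by (auto simp: supports_def)
    thus "x \<in> par ` L" using phase_child[of y x k] by (auto simp: L_def children_iff)
  qed
  hence "card {x \<in> supports. phase k x = 0} \<le> card L"
    using fin surj_card_le by blast
  hence "card (level_dom k) \<le> card P + card L"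
    unfolding level_dom_def P_def[symmetric]
    using card_Un_le[of P "{x \<in> supports. phase k x = 0}"] by linarith
  moreover have "card P + card L = card (P \<union> L)"
    using fin by (subst card_Un_disjoint) (auto simp: P_def L_def)
  moreover have "card (P \<union> L) + card (level_set k) = card (P \<union> L \<union> level_set k)"
    using fin by (subst card_Un_disjoint) (auto simp: P_def L_def level_set_def)
  moreover have "card (P \<union> L \<union> level_set k) \<le> card (pverts T)"
    using finite_verts by (intro card_mono) (auto simp: P_def L_def level_set_def leaves_def)
  ultimately show ?thesis by linarith
qed

lemma card_level_sets:
  "card (level_set 0) + card (level_set 1) + card (level_set 2) = card (pverts T)"
proof -
  have fin: "finite (level_set k)" for k using finite_verts by (auto simp: level_set_def)
  have disj: "level_set 0 \<inter> level_set 1 = {}" "(level_set 0 \<union> level_set 1) \<inter> level_set 2 = {}"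
    unfolding level_set_def phase_def by (auto, presburger+)
  have "pverts T = level_set 0 \<union> level_set 1 \<union> level_set 2"
    unfolding level_set_def phase_def by (auto, presburger)
  thus ?thesis using card_Un_disjoint[OF fin fin disj(1)]
      card_Un_disjoint[OF finite_UnI[OF fin fin] fin disj(2)] by simp
qed

lemma level_set_mod: "level_set (k mod 3) = level_set k" "level_dom (k mod 3) = level_dom k"
  by (simp_all add: level_set_def level_dom_def phase_def mod_add_right_eq)

end

text \<open>A root at distance two from a leaf is itself dominated by each of the sets \<open>level_dom k\<close>.\<close>

locale well_rooted_tree = rooted_tree +
  fixes w l
  assumes w: "w \<in> children r" and l: "l \<in> children w" and l_leaf: "l \<in> leaves"
begin

lemma w_support: "w \<in> supports"
  using l l_leaf child_in by (auto simp: supports_def)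

text \<open>A vertex in phase 0 or 2 is dominated by its parent, a leaf in phase 1 by its supporting
  parent, and any other vertex in phase 1 by a child in phase 2. Only the root in phase 0 or 2 lacks
  such a parent; there \<open>w\<close> serves, as a non-leaf in phase 1 or as a support in phase
  0.\<close>

lemma total_dominating_level_dom: "total_dominating_set T (level_dom k)"
proof (rule total_dominating_setI)
  show "level_dom k \<subseteq> pverts T" by (auto simp: level_dom_def supports_def)
  fix x assume x: "x \<in> pverts T"
  have wl: "w \<notin> leaves" using l by (auto simp: leaves_def)
  show "(\<exists>y\<in>children x. y \<in> level_dom k) \<or> x \<noteq> r \<and> par x \<in> level_dom k"
  proof (cases rule: phase_cases[of k x])
    case 1
    show ?thesis
    proof (cases "x = r")
      case True
      hence "w \<in> level_dom k"
        using 1 w wl phase_child[of w r k] child_in by (auto simp: level_dom_def)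
      thus ?thesis using True w by blast
    next
      case False
      hence "phase k (par x) = 2" using phase_child[OF child_of_par[OF x False], of k] 1
        by (cases rule: phase_cases[of k "par x"]) auto
      thus ?thesis using False x par_in by (auto simp: level_dom_def)
    qed
  next
    case 2
    show ?thesis
    proof (cases "x \<in> leaves")
      case True
      have "x \<noteq> r" using True w by (auto simp: leaves_def)
      moreover have "phase k (par x) = 0" using phase_child[OF child_of_par[OF x \<open>x \<noteq> r\<close>], of k] 2
        by (cases rule: phase_cases[of k "par x"]) auto
      moreover have "par x \<in> supports"
        using True x \<open>x \<noteq> r\<close> par_in child_of_par by (auto simp: supports_def)
      ultimately show ?thesis by (auto simp: level_dom_def)
    next
      case False
      then obtain y where "y \<in> children x" using x by (auto simp: leaves_def)
      moreover have "y \<in> level_dom k"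
        using calculation phase_child[of y x k] child_in 2 by (auto simp: level_dom_def)
      ultimately show ?thesis by blast
    qed
  next
    case 3
    show ?thesis
    proof (cases "x = r")
      case True
      hence "w \<in> level_dom k"
        using 3 w w_support phase_child[of w r k] child_in by (auto simp: level_dom_def)
      thus ?thesis using True w by blast
    next
      case False
      have "phase k (par x) = 1" using phase_child[OF child_of_par[OF x False], of k] 3
        by (cases rule: phase_cases[of k "par x"]) auto
      thus ?thesis using False x par_in child_of_par by (auto simp: level_dom_def leaves_def)
    qed
  qed
qed

lemma total_domination_number_bound: "3 * total_domination_number T \<le> 2 * card (pverts T)"
proof -
  have "total_domination_number T + card (level_set k) \<le> card (pverts T)" for k
    using total_domination_number_le[OF total_dominating_level_dom[of k]] card_level_dom[of k]
    by linarith
  \<comment> \<open>The three level sets partition the vertices, so adding the three inequalities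
    gives \<open>3t + n \<le> 3n\<close>, with \<open>t\<close> the total domination number and
    \<open>n\<close> the order.\<close>
  from this[of 0] this[of 1] this[of 2] card_level_sets show ?thesis by linarith
qed

end

section \<open>Structure of trees attaining the total domination bound\<close>

locale extremal_tree = well_rooted_tree +
  assumes extremal: "3 * total_domination_number T = 2 * card (pverts T)"
begin

text \<open>The three inequalities behind the bound add up to an equality, so each of them is an
  equality.\<close>

lemma level_dom_minimum: "card (level_dom k) = total_domination_number T"
proof -
  have le: "total_domination_number T \<le> card (level_dom k)" for k
    by (rule total_domination_number_le[OF total_dominating_level_dom])
  have *: "card (level_dom k) + card (level_set k) \<le> card (pverts T)" for k
    by (rule card_level_dom)
  have "card (level_dom k) = total_domination_number T" if "k \<in> {0, 1, 2}" for k
    using that le[of 0] le[of 1] le[of 2] *[of 0] *[of 1] *[of 2] card_level_sets extremal by auto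
  moreover have "k mod 3 \<in> {0, 1, 2}" by auto
  ultimately show ?thesis using level_set_mod by metis
qed

text \<open>In \<open>level_dom k\<close>, for suitable \<open>k\<close>, the vertex \<open>x\<close> is then needed at most for its parent.\<close>

lemma only_child:
  assumes x: "x \<in> children p"
    and grandchild: "\<And>y. y \<in> children x \<Longrightarrow> \<exists>z\<in>children y. z \<notin> leaves"
  shows "children p = {x}"
proof (rule ccontr)
  assume "children p \<noteq> {x}"
  then obtain z where z: "z \<in> children p" "z \<noteq> x" using x by blast
  \<comment> \<open>In phase 2 both \<open>x\<close> and its sibling \<open>z\<close> belong to the
    set whatever their kind, and the children of the children of \<open>x\<close> are in phase 1,
    where every non-leaf belongs to it.\<close>
  obtain k where k: "phase k x = 2" by (rule phase_shift)
  have pk: "phase k p = 1" using phase_child[OF x, of k] k by (cases rule: phase_cases[of k p]) auto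
  let ?D = "level_dom k"
  have xD: "x \<in> ?D" using k x child_in by (auto simp: level_dom_def)
  have zD: "z \<in> ?D" using phase_child[OF z(1), of k] pk z child_in by (auto simp: level_dom_def)
  have "total_dominating_set T (?D - {x})"
  proof (rule total_dominating_setI)
    show "?D - {x} \<subseteq> pverts T" by (auto simp: level_dom_def supports_def)
    fix v assume v: "v \<in> pverts T"
    have "open_neighborhood T v \<inter> ?D \<noteq> {}"
      using total_dominating_level_dom[of k] v by (simp add: total_dominating_set_def)
    then obtain y where y: "y \<in> ?D" "y \<in> children v \<or> v \<noteq> r \<and> y = par v"
      unfolding open_neighborhood_eq[OF v] by (cases "v = r") auto
    \<comment> \<open>Removing \<open>x\<close> can only affect its neighbours: its parent
      \<open>p\<close>, still dominated by \<open>z\<close>, and its children, dominated by their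
      non-leaf children.\<close>
    consider "v = p" | "v \<in> children x" | "y \<noteq> x"
    proof (cases "y = x")
      case True
      thus ?thesis using y(2) x v that(1,2) by (auto simp: children_iff)
    qed (use that in blast)
    thus "(\<exists>y\<in>children v. y \<in> ?D - {x}) \<or> v \<noteq> r \<and> par v \<in> ?D - {x}"
    proof cases
      case 1 thus ?thesis using z zD by blast
    next
      case 2
      obtain u where u: "u \<in> children v" "u \<notin> leaves" using grandchild[OF 2] by blast
      have "phase k u = 1" using phase_child[OF 2, of k] phase_child[OF u(1), of k] k by simp
      hence "u \<in> ?D - {x}" using u child_in k by (auto simp: level_dom_def)
      thus ?thesis using u by blast
    next
      case 3 thus ?thesis using y by blast
    qed
  qed
  hence "card ?D \<le> card (?D - {x})" using total_domination_number_le level_dom_minimum by metis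
  moreover have "finite ?D" using finite_verts by (auto simp: level_dom_def supports_def)
  ultimately show False using xD by (metis card_Diff1_less leD)
qed

lemma root_not_leaf: "r \<notin> leaves"
  using w by (auto simp: leaves_def)

text \<open>A leaf meets the condition on grandchildren in \<open>only_child\<close>
  vacuously.\<close>

lemma support_children: "a \<in> supports \<Longrightarrow> \<exists>c\<in>leaves. children a = {c}"
  using only_child by (fastforce simp: supports_def leaves_def)

lemma support_not_leaf: "a \<in> supports \<Longrightarrow> a \<notin> leaves"
  by (auto simp: supports_def leaves_def)

text \<open>The child \<open>w\<close> of the root is not a leaf, while the only child of a support
  is one.\<close>

lemma root_inner: "r \<in> inner"
proof -
  have "r \<notin> supports"
    using support_children[of r] w w_support support_not_leaf by force
  thus ?thesis using root root_not_leaf by (auto simp: inner_def)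
qed

lemma par_leaf: "c \<in> leaves \<Longrightarrow> par c \<in> supports"
  using root_not_leaf par_in child_of_par by (fastforce simp: supports_def leaves_def)

lemma par_inner:
  assumes "x \<in> pverts T" "x \<noteq> r" "x \<notin> leaves"
  shows "par x \<in> inner"
proof -
  have "par x \<notin> supports"
    using support_children[of "par x"] child_of_par[OF assms(1,2)] assms(3) by auto
  moreover have "par x \<notin> leaves" using child_of_par[OF assms(1,2)] by (auto simp: leaves_def)
  ultimately show ?thesis using par_in assms by (auto simp: inner_def)
qed

text \<open>Induction from the root downwards. If no child of \<open>x\<close> is a support, then
  each child has a non-leaf child, and \<open>only_child\<close> makes \<open>x\<close> the only
  child of its parent. The parent is inner and by induction has a support child, which would have to
  be \<open>x\<close> itself.\<close>

lemma inner_has_support_child: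
  "x \<in> inner \<Longrightarrow> children x \<inter> supports \<noteq> {}"
proof (induction "lev x" arbitrary: x rule: less_induct)
  case less
  show ?case
  proof
    assume none: "children x \<inter> supports = {}"
    have grandchild: "\<exists>z\<in>children y. z \<notin> leaves" if y: "y \<in> children x" for y
    proof -
      have "y \<notin> leaves" using y less.prems child_in[OF y] by (auto simp: inner_def supports_def)
      moreover have "y \<notin> supports" using y none by blast
      ultimately show ?thesis using child_in[OF y] by (auto simp: leaves_def supports_def)
    qed
    have "x \<noteq> r" using none w w_support by blast
    have x: "x \<in> pverts T" "x \<notin> leaves" "x \<notin> supports" using less.prems by (auto simp: inner_def)
    have "children (par x) = {x}"
      using only_child[OF child_of_par[OF x(1) \<open>x \<noteq> r\<close>] grandchild] .
    moreover have "children (par x) \<inter> supports \<noteq> {}"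
      using less.hyps[of "par x"] par_inner[OF x(1) \<open>x \<noteq> r\<close> x(2)] lev_par[OF x(1) \<open>x \<noteq> r\<close>]
      by simp
    ultimately show False using x by auto
  qed
qed

lemma total_dominating_supports_inner: "total_dominating_set T (supports \<union> inner)"
proof (rule total_dominating_setI)
  show "supports \<union> inner \<subseteq> pverts T" by (auto simp: supports_def inner_def)
  fix x assume x: "x \<in> pverts T"
  consider "x \<in> leaves" | "x \<in> supports" | "x \<in> inner" using x by (auto simp: inner_def)
  thus "(\<exists>y\<in>children x. y \<in> supports \<union> inner) \<or> x \<noteq> r \<and> par x \<in> supports \<union> inner"
  proof cases
    case 1 thus ?thesis using par_leaf root_not_leaf by blast
  next
    case 2
    hence "x \<noteq> r" using root_inner by (auto simp: inner_def)
    thus ?thesis using par_inner x 2 support_not_leaf by blast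
  next
    case 3 thus ?thesis using inner_has_support_child by blast
  qed
qed

text \<open>Let \<open>s\<close>, \<open>i\<close> and \<open>m\<close> count supports, inner
  vertices and leaves. Extremality and the total dominating set of supports and inner vertices give
  \<open>3(s + i) \<ge> 2(s + i + m)\<close>, so \<open>s + i \<ge> 2m \<ge> 2s\<close> and
  \<open>i \<ge> s\<close>. As \<open>par\<close> maps the supports onto a set containing all inner
  vertices, it is injective on them.\<close>

lemma inj_par_supports: "inj_on par supports"
proof -
  have fin: "finite supports" "finite inner" "finite leaves"
    using finite_verts by (auto simp: supports_def inner_def leaves_def)
  have "card (supports \<union> inner) = card supports + card inner"
    using fin by (intro card_Un_disjoint) (auto simp: inner_def)
  moreover have "card (supports \<union> inner \<union> leaves) = card (supports \<union> inner) + card leaves"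
    using fin support_not_leaf by (intro card_Un_disjoint) (auto simp: inner_def)
  moreover have "supports \<union> inner \<union> leaves = pverts T"
    by (auto simp: supports_def inner_def leaves_def)
  moreover have "total_domination_number T \<le> card (supports \<union> inner)"
    by (rule total_domination_number_le[OF total_dominating_supports_inner])
  moreover have "supports \<subseteq> par ` leaves"
    by (auto simp: supports_def children_def)
  hence "card supports \<le> card leaves" using fin surj_card_le by blast
  moreover have sub: "inner \<subseteq> par ` supports"
    using inner_has_support_child by (fastforce simp: children_def)
  hence "card inner \<le> card supports" using fin surj_card_le by blast
  ultimately have "card supports \<le> card inner" using extremal by simp
  moreover have "card inner \<le> card (par ` supports)" using fin sub by (intro card_mono) auto
  moreover have "card (par ` supports) \<le> card supports" using fin by (intro card_image_le)
  ultimately show ?thesis using fin by (intro eq_card_imp_inj_on) auto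
qed

end

text \<open>For an arbitrary root a deepest vertex \<open>l\<close> is a leaf. The new root is a
  neighbour, other than \<open>l\<close>, of the parent \<open>w\<close> of
  \<open>l\<close>.\<close>

lemma undirected_tree_well_rooting:
  assumes tree: "undirected_tree T" and card: "3 \<le> card (pverts T)"
  obtains r par lev w l where "well_rooted_tree T r par lev w l"
proof -
  obtain r0 where r0: "r0 \<in> pverts T" using card by fastforce
  obtain par0 lev0 where "rooted_tree T r0 par0 lev0" using undirected_tree_rooting[OF tree r0] .
  then interpret R: rooted_tree T r0 par0 lev0 .
  have others: "\<exists>z\<in>pverts T. z \<noteq> x \<and> z \<noteq> y" for x y
  proof (rule ccontr)
    assume "\<not> ?thesis"
    hence "pverts T \<subseteq> {x, y}" by blast
    hence "card (pverts T) \<le> card {x, y}" by (intro card_mono) auto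
    also have "\<dots> \<le> 2" by (simp add: card_insert_if)
    finally show False using card by simp
  qed
  have "Max (lev0 ` pverts T) \<in> lev0 ` pverts T"
    using R.finite_verts r0 by (intro Max_in) auto
  then obtain l where l: "l \<in> pverts T" "lev0 l = Max (lev0 ` pverts T)" by force
  hence deepest: "lev0 x \<le> lev0 l" if "x \<in> pverts T" for x
    using R.finite_verts that by simp
  note l = l(1)
  have "l \<noteq> r0"
    using others[of r0 r0] deepest R.lev_root R.lev_par by fastforce
  have no_children: "R.children l = {}" using deepest R.lev_child R.child_in by fastforce
  define w where "w = par0 l"
  have w: "w \<in> pverts T" using l \<open>l \<noteq> r0\<close> R.par_in by (simp add: w_def)
  have lw: "(l, w) \<in> parcs T" using l \<open>l \<noteq> r0\<close> by (simp add: R.arcs_iff w_def)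
  have l_nbr: "y = w" if "(l, y) \<in> parcs T" for y
    using that no_children l by (auto simp: R.arcs_iff w_def R.children_def)
  obtain r where r: "r \<in> pverts T" "r \<noteq> l" "(r, w) \<in> parcs T"
  proof (cases "w = r0")
    case False
    hence "lev0 l = Suc (Suc (lev0 (par0 w)))"
      using R.lev_par[OF l \<open>l \<noteq> r0\<close>] R.lev_par[OF w False] by (simp add: w_def)
    hence "par0 w \<noteq> l" by auto
    thus ?thesis using that[of "par0 w"] False w R.par_in by (auto simp: R.arcs_iff)
  next
    case True
    \<comment> \<open>Here \<open>l\<close> has level 1 and is deepest, so the tree is a star
      centred at \<open>w\<close> and any third vertex is a neighbour of \<open>w\<close>.\<close>
    obtain z where z: "z \<in> pverts T" "z \<noteq> l" "z \<noteq> r0" using others by blast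
    have "lev0 l = 1" using R.lev_par[OF l \<open>l \<noteq> r0\<close>] True R.lev_root by (simp add: w_def)
    hence "lev0 (par0 z) = 0" using deepest[OF z(1)] R.lev_par[OF z(1,3)] by simp
    hence "par0 z = r0" using R.lev_par[OF R.par_in[OF z(1,3)]] by auto
    thus ?thesis using that[of z] z True by (simp add: R.arcs_iff)
  qed
  obtain par lev where "rooted_tree T r par lev" using undirected_tree_rooting[OF tree r(1)] .
  then interpret N: rooted_tree T r par lev .
  have "w \<noteq> r" "par w = r" using r(3) N.lev_par[of r] by (auto simp: N.arcs_iff)
  hence "w \<in> N.children r" using w by (simp add: N.children_def)
  moreover have "l \<in> N.children w"
    using lw r(2) \<open>par w = r\<close> l by (auto simp: N.arcs_iff N.children_def)
  moreover have "l \<in> N.leaves"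
    using l_nbr l r(2) \<open>par w = r\<close> unfolding N.leaves_def N.children_def N.arcs_iff by auto
  ultimately have "well_rooted_tree T r par lev w l" by unfold_locales
  thus thesis by (rule that)
qed

subsection \<open>Super domination\<close>

text \<open>The chosen \<open>f u\<close> determines \<open>u\<close> as its only neighbour outside
  \<open>S\<close>.\<close>

lemma super_dominating_injection:
  assumes "super_dominating_set G S"
  obtains f where "inj_on f (pverts G - S)" "f ` (pverts G - S) \<subseteq> S"
    "\<forall>u\<in>pverts G - S. open_neighborhood G (f u) \<inter> (pverts G - S) = {u}"
proof -
  obtain f where f: "\<forall>u\<in>pverts G - S. f u \<in> S \<and> open_neighborhood G (f u) \<inter> (pverts G - S) = {u}"
    using assms unfolding super_dominating_set_def by metis
  hence "inj_on f (pverts G - S)" by (intro inj_onI) (metis singleton_inject)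
  thus thesis using that f by blast
qed

lemma card_le_super_dominating:
  assumes S: "super_dominating_set G S" and fin: "finite (pverts G)"
  shows "card (pverts G) \<le> 2 * card S"
proof -
  obtain f where "inj_on f (pverts G - S)" "f ` (pverts G - S) \<subseteq> S"
    using super_dominating_injection[OF S] .
  moreover have sub: "S \<subseteq> pverts G" using S by (simp add: super_dominating_set_def)
  ultimately have "card (pverts G - S) \<le> card S" using fin by (meson card_inj_on_le finite_subset)
  thus ?thesis using sub fin by (simp add: card_Diff_subset finite_subset)
qed

text \<open>If \<open>S\<close> is exactly half of the vertices, the injection of the complement
  into \<open>S\<close> is onto. Then every vertex of \<open>S\<close> has a single neighbour
  outside \<open>S\<close>, and the edges between the two sides form a perfect matching.\<close>

lemma super_dominating_perfect_matching:
  assumes S: "super_dominating_set G S" and fin: "finite (pverts G)"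
    and half: "card (pverts G) = 2 * card S"
    and sym: "\<And>x y. (x, y) \<in> parcs G \<Longrightarrow> (y, x) \<in> parcs G"
    and x: "x \<in> pverts G"
  shows "\<exists>!y. y \<in> pverts G \<and> (x, y) \<in> parcs G \<and> (y \<in> S \<longleftrightarrow> x \<notin> S)"
proof -
  obtain f where inj: "inj_on f (pverts G - S)" and im: "f ` (pverts G - S) \<subseteq> S"
    and priv: "\<forall>u\<in>pverts G - S. open_neighborhood G (f u) \<inter> (pverts G - S) = {u}"
    using super_dominating_injection[OF S] .
  have sub: "S \<subseteq> pverts G" using S by (simp add: super_dominating_set_def)
  have "card (f ` (pverts G - S)) = card S"
    using inj half sub fin by (simp add: card_image card_Diff_subset finite_subset)
  hence onto: "f ` (pverts G - S) = S" using im sub fin by (metis card_subset_eq finite_subset)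
  have adj: "(f u, y) \<in> parcs G \<longleftrightarrow> y = u" if "u \<in> pverts G - S" "y \<in> pverts G - S" for u y
    using bspec[OF priv that(1)] that(2) by (auto simp: open_neighborhood_def)
  show ?thesis
  proof (cases "x \<in> S")
    case True
    then obtain u where u: "u \<in> pverts G - S" "x = f u" using onto by blast
    thus ?thesis using adj[OF u(1)] True by blast
  next
    case False
    have "y = f x" if "y \<in> S" "(x, y) \<in> parcs G" for y
    proof -
      from that(1) onto obtain u where u: "u \<in> pverts G - S" "y = f u" by (metis imageE)
      have "(f u, x) \<in> parcs G" using sym[OF that(2)] u(2) by simp
      thus ?thesis using adj[OF u(1), of x] x False u(2) by simp
    qed
    moreover have "(x, f x) \<in> parcs G" "f x \<in> S"
      using sym[of "f x" x] adj[of x x] x False im by auto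
    ultimately show ?thesis using False sub by blast
  qed
qed

section \<open>Decomposing an extremal tree into 6-vertex paths\<close>

lemma parcs_path6:
  "parcs (path_graph [u1, u2, u3, u4, u5, u6]) =
     {(u6, u5), (u5, u6), (u5, u4), (u4, u5), (u4, u3), (u3, u4), (u2, u3), (u3, u2), (u1, u2), (u2, u1)}"
  by (auto simp: path_graph_def)

locale extremal_super_tree = extremal_tree +
  fixes S
  assumes super: "super_dominating_set T S" and half: "card (pverts T) = 2 * card S"
begin

text \<open>The partner in the perfect matching between \<open>S\<close> and its complement;
  \<open>ex1_mate\<close> makes it well defined on the vertices of \<open>T\<close>.\<close>

definition mate :: "'a \<Rightarrow> 'a" where
  "mate x = (THE y. y \<in> pverts T \<and> (x, y) \<in> parcs T \<and> (y \<in> S \<longleftrightarrow> x \<notin> S))"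

lemma arcs_sym: "(x, y) \<in> parcs T \<Longrightarrow> (y, x) \<in> parcs T"
  by (auto simp: arcs_iff)

lemma ex1_mate:
  "x \<in> pverts T \<Longrightarrow> \<exists>!y. y \<in> pverts T \<and> (x, y) \<in> parcs T \<and> (y \<in> S \<longleftrightarrow> x \<notin> S)"
  by (rule super_dominating_perfect_matching[OF super finite_verts half arcs_sym])

lemma mate:
  assumes "x \<in> pverts T"
  shows "mate x \<in> pverts T" "(x, mate x) \<in> parcs T" "mate x \<in> S \<longleftrightarrow> x \<notin> S"
  using theI'[OF ex1_mate[OF assms]] by (auto simp: mate_def)

lemma mate_mate: "x \<in> pverts T \<Longrightarrow> mate (mate x) = x"
  using ex1_mate[of "mate x"] mate[of x] mate[of "mate x"] arcs_sym by blast

lemma mate_leaf: "c \<in> leaves \<Longrightarrow> mate c = par c"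
  using mate(2)[of c] by (auto simp: arcs_iff leaves_def children_def)

text \<open>A leaf can only be matched with its parent, and every support has a leaf child. So
  leaves and supports are matched with each other, which leaves the inner vertices to be matched
  among themselves.\<close>

lemma mate_inner:
  assumes "b \<in> inner"
  shows "mate b \<in> inner"
proof -
  have b: "b \<in> pverts T" "b \<notin> leaves" "b \<notin> supports" using assms by (auto simp: inner_def)
  have "mate b \<notin> leaves" using mate_leaf[of "mate b"] par_leaf mate_mate b by metis
  moreover have "mate b \<notin> supports"
  proof
    assume s: "mate b \<in> supports"
    then obtain c where "c \<in> leaves" "children (mate b) = {c}" using support_children by blast
    hence "mate c = mate b" "c \<in> pverts T" using mate_leaf by (auto simp: children_def)
    thus False using b mate_mate \<open>c \<in> leaves\<close> by metis
  qed
  ultimately show ?thesis using mate(1)[OF b(1)] by (simp add: inner_def)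
qed

lemma support_not_root: "a \<in> supports \<Longrightarrow> a \<noteq> r"
  using root_inner by (auto simp: inner_def)

text \<open>Each inner vertex carries a pendant path through its unique support child to a leaf. The
  last clause records that everything else hanging from this tail is inner.\<close>

lemma inner_tail:
  assumes b: "b \<in> inner"
  obtains a c where "a \<in> supports" "par a = b" "c \<in> leaves" "par c = a"
    "\<forall>y\<in>pverts T. y \<noteq> r \<longrightarrow> y \<notin> inner \<longrightarrow> par y \<in> {b, a, c} \<longrightarrow> y = a \<or> y = c"
proof -
  obtain a where a: "a \<in> supports" "par a = b"
    using inner_has_support_child[OF b] by (auto simp: children_def)
  obtain c where c: "c \<in> leaves" "children a = {c}" using support_children[OF a(1)] by blast
  have "y = a \<or> y = c" if y: "y \<in> pverts T" "y \<noteq> r" "y \<notin> inner" "par y \<in> {b, a, c}" for y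
  proof -
    have yc: "y \<in> children (par y)" using y by (simp add: children_def)
    consider "par y = c" | "par y = a" | "par y = b" using y by blast
    thus ?thesis
    proof cases
      case 1 thus ?thesis using yc c by (auto simp: leaves_def)
    next
      case 2 thus ?thesis using yc c by auto
    next
      case 3
      hence "y \<notin> leaves" using par_leaf[of y] b by (auto simp: inner_def)
      hence "y \<in> supports" using y by (auto simp: inner_def)
      thus ?thesis using inj_par_supports a 3 by (auto dest: inj_onD)
    qed
  qed
  thus thesis using that[of a c] a c by (auto simp: children_def)
qed

text \<open>The tails of two matched inner vertices, joined by the matching edge, form a 6-vertex
  path with statuses C, A, B, B, A, C.\<close>

lemma inner_block:
  assumes x: "x \<in> inner" and mx: "mate x \<noteq> r" "par (mate x) = x"
  obtains a c a' c' where "distinct [c, a, x, mate x, a', c']"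
    "a \<in> supports" "a' \<in> supports" "c \<in> leaves" "c' \<in> leaves"
    "par a = x" "par c = a" "par a' = mate x" "par c' = a'"
    "\<forall>y\<in>pverts T. y \<noteq> r \<longrightarrow> y \<notin> inner \<longrightarrow> par y \<in> {c, a, x, mate x, a', c'} \<longrightarrow>
       y \<in> {c, a, a', c'}"
proof -
  obtain a c where ac: "a \<in> supports" "par a = x" "c \<in> leaves" "par c = a"
    "\<forall>y\<in>pverts T. y \<noteq> r \<longrightarrow> y \<notin> inner \<longrightarrow> par y \<in> {x, a, c} \<longrightarrow> y = a \<or> y = c"
    using inner_tail[OF x] .
  obtain a' c' where ac': "a' \<in> supports" "par a' = mate x" "c' \<in> leaves" "par c' = a'"
    "\<forall>y\<in>pverts T. y \<noteq> r \<longrightarrow> y \<notin> inner \<longrightarrow> par y \<in> {mate x, a', c'} \<longrightarrow> y = a' \<or> y = c'"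
    using inner_tail[OF mate_inner[OF x]] .
  have "lev (mate x) = Suc (lev x)" using lev_par[of "mate x"] mx mate_inner[OF x] by (auto simp: inner_def)
  hence "x \<noteq> mate x" by auto
  hence "a \<noteq> a'" using ac(2) ac'(2) by metis
  hence "c \<noteq> c'" using ac(4) ac'(4) by metis
  have "x \<noteq> a" "x \<noteq> c" "x \<noteq> a'" "x \<noteq> c'" using x ac(1-4) ac'(1-4) by (auto simp: inner_def)
  moreover have "mate x \<noteq> a" "mate x \<noteq> c" "mate x \<noteq> a'" "mate x \<noteq> c'"
    using mate_inner[OF x] ac(1-4) ac'(1-4) by (auto simp: inner_def)
  moreover have "a \<noteq> c" "a \<noteq> c'" "a' \<noteq> c" "a' \<noteq> c'" using support_not_leaf ac(1-4) ac'(1-4) by auto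
  ultimately have "distinct [c, a, x, mate x, a', c']"
    using \<open>x \<noteq> mate x\<close> \<open>a \<noteq> a'\<close> \<open>c \<noteq> c'\<close> by auto
  moreover have "y \<in> {c, a, a', c'}"
    if "y \<in> pverts T" "y \<noteq> r" "y \<notin> inner" "par y \<in> {c, a, x, mate x, a', c'}" for y
    using ac(5) ac'(5) that by blast
  ultimately show thesis using that[of c a a' c'] ac(1-4) ac'(1-4) by blast
qed

text \<open>For a set of vertices closed under parents these are the arcs of the induced
  subgraph.\<close>

definition edges :: "'a set \<Rightarrow> ('a \<times> 'a) set" where
  "edges X = (\<Union>y\<in>X - {r}. {(y, par y), (par y, y)})"

text \<open>Such a set is a union of whole blocks reaching up to the root: it is closed under
  parents, tails and mates of inner vertices. Hence a vertex outside whose parent lies inside is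
  inner, and its mate lies outside.\<close>

definition block_closed :: "'a set \<Rightarrow> bool" where
  "block_closed X \<longleftrightarrow> X \<subseteq> pverts T \<and> r \<in> X \<and> (\<forall>y\<in>X. y \<noteq> r \<longrightarrow> par y \<in> X) \<and>
     (\<forall>y\<in>pverts T. y \<noteq> r \<longrightarrow> y \<notin> inner \<longrightarrow> par y \<in> X \<longrightarrow> y \<in> X) \<and>
     (\<forall>b\<in>X \<inter> inner. mate b \<in> X)"

definition realised :: "'a set \<Rightarrow> bool" where
  "realised X \<longleftrightarrow> block_closed X \<and>
     (\<lparr>pverts = X, parcs = edges X\<rparr>, (supports \<inter> X, inner \<inter> X, leaves \<inter> X)) \<in> labeled_tree_family"

lemma realised_root: "\<exists>X. realised X"
proof -
  have "(r, mate r) \<in> parcs T" by (rule mate(2)[OF root])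
  \<comment> \<open>The root has no parent, so its mate is a child and the block of the root
    exists.\<close>
  hence m: "mate r \<noteq> r" "par (mate r) = r" by (auto simp: arcs_iff)
  obtain a c a' c' where d: "distinct [c, a, r, mate r, a', c']"
    and st: "a \<in> supports" "a' \<in> supports" "c \<in> leaves" "c' \<in> leaves"
    and par: "par a = r" "par c = a" "par a' = mate r" "par c' = a'"
    and bl: "\<forall>y\<in>pverts T. y \<noteq> r \<longrightarrow> y \<notin> inner \<longrightarrow> par y \<in> {c, a, r, mate r, a', c'} \<longrightarrow>
       y \<in> {c, a, a', c'}"
    using inner_block[OF root_inner m] .
  let ?X = "{c, a, r, mate r, a', c'}"
  have mi: "mate r \<in> inner" by (rule mate_inner[OF root_inner])
  have cl: "block_closed ?X"
    unfolding block_closed_def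
  proof (intro conjI ballI impI)
    show "?X \<subseteq> pverts T" using st mi root by (auto simp: supports_def leaves_def inner_def)
    show "par y \<in> ?X" if "y \<in> ?X" "y \<noteq> r" for y using that par m by auto
    show "y \<in> ?X" if "y \<in> pverts T" "y \<noteq> r" "y \<notin> inner" "par y \<in> ?X" for y
      using bl that by blast
    show "mate b \<in> ?X" if "b \<in> ?X \<inter> inner" for b
      using that st mate_mate[OF root] by (auto simp: inner_def)
  qed simp
  have "edges ?X = parcs (path_graph [c, a, r, mate r, a', c'])"
  proof -
    have "?X - {r} = {c, a, mate r, a', c'}" using d by auto
    thus ?thesis unfolding edges_def parcs_path6 by (simp add: par m)
  qed
  hence G: "\<lparr>pverts = ?X, parcs = edges ?X\<rparr> = path_graph [c, a, r, mate r, a', c']"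
    by (simp add: path_graph_def)
  have L: "supports \<inter> ?X = {a, a'}" "inner \<inter> ?X = {r, mate r}" "leaves \<inter> ?X = {c, c'}"
    using st mi root_inner support_not_leaf by (auto simp: inner_def)
  have "realised ?X" unfolding realised_def G L using cl labeled_tree_family.path6[OF d] by blast
  thus ?thesis ..
qed

text \<open>A vertex \<open>x\<close> of least level outside \<open>X\<close> has its parent in
  \<open>X\<close>. Closure makes \<open>x\<close> inner, and its block is attached at its third
  vertex \<open>x\<close> to \<open>par x\<close>, which is inner and so has status B.\<close>

lemma realised_grow:
  assumes X: "realised X" and neq: "X \<noteq> pverts T"
  shows "\<exists>X'. realised X' \<and> X \<subset> X'"
proof -
  from X have sub: "X \<subseteq> pverts T" and rX: "r \<in> X"
    and pX: "\<And>y. y \<in> X \<Longrightarrow> y \<noteq> r \<Longrightarrow> par y \<in> X"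
    and tX: "\<And>y. y \<in> pverts T \<Longrightarrow> y \<noteq> r \<Longrightarrow> y \<notin> inner \<Longrightarrow> par y \<in> X \<Longrightarrow> y \<in> X"
    and mX: "\<And>b. b \<in> X \<Longrightarrow> b \<in> inner \<Longrightarrow> mate b \<in> X"
    by (auto simp: realised_def block_closed_def)
  obtain x where x: "x \<in> pverts T - X" and min: "\<And>z. z \<in> pverts T - X \<Longrightarrow> lev x \<le> lev z"
    using neq sub ex_has_least_nat[of "\<lambda>z. z \<in> pverts T - X" _ lev] by blast
  have xr: "x \<noteq> r" using x rX by blast
  have vX: "par x \<in> X"
    using min[of "par x"] lev_par[of x] par_in[of x] x xr by fastforce
  have xi: "x \<in> inner" using tX[of x] x xr vX by blast
  have vi: "par x \<in> inner" using par_inner[of x] xi xr by (auto simp: inner_def)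
  have "mate x \<notin> X" using mX[of "mate x"] mate_inner[OF xi] mate_mate[of x] x by auto
  \<comment> \<open>The parent of \<open>x\<close> is in \<open>X\<close> but its mate is not, so
    the mate is a child.\<close>
  have mx: "mate x \<noteq> r" "par (mate x) = x"
    using mate(2)[of x] x vX \<open>mate x \<notin> X\<close> rX by (auto simp: arcs_iff)
  obtain a c a' c' where d: "distinct [c, a, x, mate x, a', c']"
    and st: "a \<in> supports" "a' \<in> supports" "c \<in> leaves" "c' \<in> leaves"
    and par: "par a = x" "par c = a" "par a' = mate x" "par c' = a'"
    and bl: "\<forall>y\<in>pverts T. y \<noteq> r \<longrightarrow> y \<notin> inner \<longrightarrow> par y \<in> {c, a, x, mate x, a', c'} \<longrightarrow>
       y \<in> {c, a, a', c'}"
    using inner_block[OF xi mx] .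
  let ?B = "{c, a, x, mate x, a', c'}"
  have nr: "a \<noteq> r" "a' \<noteq> r" "c \<noteq> r" "c' \<noteq> r" using st support_not_root root_not_leaf by auto
  \<comment> \<open>\<open>X\<close> is closed under parents, so a block vertex in \<open>X\<close>
    would pull \<open>x\<close> or \<open>mate x\<close> into \<open>X\<close>.\<close>
  have fresh: "?B \<inter> X = {}" 
    using pX[of a] pX[of c] pX[of a'] pX[of c'] par nr x \<open>mate x \<notin> X\<close> by auto
  have mi: "mate x \<in> inner" by (rule mate_inner[OF xi])
  have cl: "block_closed (X \<union> ?B)"
    unfolding block_closed_def
  proof (intro conjI ballI impI)
    show "X \<union> ?B \<subseteq> pverts T" using st xi mi sub by (auto simp: supports_def leaves_def inner_def)
    show "r \<in> X \<union> ?B" using rX by blast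
    show "par y \<in> X \<union> ?B" if "y \<in> X \<union> ?B" "y \<noteq> r" for y using that par pX mx vX by auto
    show "y \<in> X \<union> ?B" if "y \<in> pverts T" "y \<noteq> r" "y \<notin> inner" "par y \<in> X \<union> ?B" for y
      using bl tX[OF that(1-3)] that by blast
    show "mate b \<in> X \<union> ?B" if "b \<in> (X \<union> ?B) \<inter> inner" for b
      using that st mate_mate[of x] x mX by (auto simp: inner_def)
  qed
  have "edges ?B = parcs (path_graph [c, a, x, mate x, a', c']) \<union> {(x, par x), (par x, x)}"
  proof -
    have "?B - {r} = {c, a, mate x, a', c', x}" using nr mx xr by auto
    thus ?thesis unfolding edges_def parcs_path6 by (simp add: par mx)
  qed
  moreover have "edges (X \<union> ?B) = edges X \<union> edges ?B" unfolding edges_def by blast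
  ultimately have E: "edges (X \<union> ?B) =
      edges X \<union> parcs (path_graph [c, a, x, mate x, a', c']) \<union> {(x, par x), (par x, x)}"
    by blast
  have L: "supports \<inter> (X \<union> ?B) = supports \<inter> X \<union> {a, a'}"
    "inner \<inter> (X \<union> ?B) = inner \<inter> X \<union> {x, mate x}"
    "leaves \<inter> (X \<union> ?B) = leaves \<inter> X \<union> {c, c'}"
    using st mi xi support_not_leaf by (auto simp: inner_def)
  have "realised (X \<union> ?B)"
    using labeled_tree_family.attach[of "\<lparr>pverts = X, parcs = edges X\<rparr>" "supports \<inter> X" "inner \<inter> X"
        "leaves \<inter> X" "par x", OF _ _ d] X fresh cl vX vi
    unfolding realised_def E L by simp
  moreover have "X \<subset> X \<union> ?B" using x by blast
  ultimately show ?thesis by blast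
qed

text \<open>A maximal realised set exists by finiteness, and since every proper one can grow, it is
  the whole vertex set.\<close>

lemma in_labeled_tree_family: "(T, (supports, inner, leaves)) \<in> labeled_tree_family"
proof -
  have "{X. realised X} \<subseteq> Pow (pverts T)" by (auto simp: realised_def block_closed_def)
  hence "finite {X. realised X}" using finite_verts finite_subset by blast
  then obtain X where X: "realised X" and max: "\<And>X'. realised X' \<Longrightarrow> X \<subseteq> X' \<Longrightarrow> X = X'"
    using finite_has_maximal[of "{X. realised X}"] realised_root by auto
  have "X = pverts T" using realised_grow[OF X] max by blast
  moreover have "edges (pverts T) = parcs T" by (auto simp: edges_def arcs_iff)
  moreover have "supports \<inter> pverts T = supports" "inner \<inter> pverts T = inner" "leaves \<inter> pverts T = leaves"
    by (auto simp: supports_def inner_def leaves_def)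
  moreover have "T = \<lparr>pverts = pverts T, parcs = parcs T\<rparr>" by simp
  ultimately show ?thesis using X unfolding realised_def by metis
qed

lemma is_labeling: "is_labeling T (supports, inner, leaves)"
  using support_not_leaf by (auto simp: is_labeling_def supports_def inner_def leaves_def)

end

subsection \<open>Trees of the family\<close>

lemma labeled_tree_family_wf:
  assumes "(T, (SA, SB, SC)) \<in> labeled_tree_family"
  shows "finite (pverts T) \<and> parcs T \<subseteq> pverts T \<times> pverts T \<and> SA \<union> SB \<union> SC \<subseteq> pverts T \<and> SB \<inter> (SA \<union> SC) = {}"
  using assms
proof (induction T SA SB SC rule: labeled_tree_family.induct)
  case (path6 u1 u2 u3 u4 u5 u6)
  thus ?case by (auto simp: parcs_path6) (auto simp: path_graph_def)
next
  case (attach T SA SB SC v u1 u2 u3 u4 u5 u6)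
  let ?B = "{u1, u2, u3, u4, u5, u6}"
  have wf: "finite (pverts T)" "parcs T \<subseteq> pverts T \<times> pverts T" "SA \<union> SB \<union> SC \<subseteq> pverts T"
    "SB \<inter> (SA \<union> SC) = {}" using attach.IH by auto
  have v: "v \<in> pverts T" using attach.hyps(2) wf(3) by blast
  have old: "?B \<inter> (SA \<union> SB \<union> SC) = {}" using attach.hyps(4) wf(3) by blast
  have new: "{u3, u4} \<inter> ({u2, u5} \<union> {u1, u6}) = {}" using attach.hyps(3) by auto
  have "parcs T \<subseteq> (pverts T \<union> ?B) \<times> (pverts T \<union> ?B)" using wf(2) by blast
  moreover have "parcs (path_graph [u1, u2, u3, u4, u5, u6]) \<subseteq> (pverts T \<union> ?B) \<times> (pverts T \<union> ?B)"
    by (simp add: parcs_path6)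
  moreover have "{(u3, v), (v, u3)} \<subseteq> (pverts T \<union> ?B) \<times> (pverts T \<union> ?B)" using v by simp
  moreover have "SA \<union> {u2, u5} \<union> (SB \<union> {u3, u4}) \<union> (SC \<union> {u1, u6}) \<subseteq> pverts T \<union> ?B"
    using wf(3) by blast
  moreover have "(SB \<union> {u3, u4}) \<inter> (SA \<union> {u2, u5} \<union> (SC \<union> {u1, u6})) = {}"
    using wf(4) old new by blast
  ultimately show ?case using wf(1) by simp
qed

locale path_attachment =
  fixes T T' :: "'a pair_pre_digraph" and v u1 u2 u3 u4 u5 u6 :: 'a
  assumes arcs: "parcs T \<subseteq> pverts T \<times> pverts T"
    and v: "v \<in> pverts T"
    and dist: "distinct [u1, u2, u3, u4, u5, u6]"
    and fresh: "{u1, u2, u3, u4, u5, u6} \<inter> pverts T = {}"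
    and T': "T' = \<lparr>pverts = pverts T \<union> {u1, u2, u3, u4, u5, u6},
        parcs = parcs T \<union> parcs (path_graph [u1, u2, u3, u4, u5, u6]) \<union> {(u3, v), (v, u3)}\<rparr>"
begin

lemma neighborhood_old:
  "x \<in> pverts T \<Longrightarrow> open_neighborhood T' x = open_neighborhood T x \<union> (if x = v then {u3} else {})"
  using arcs v fresh by (auto simp: open_neighborhood_def T' parcs_path6)

lemma neighborhood_new:
  "open_neighborhood T' u1 = {u2}" "open_neighborhood T' u2 = {u1, u3}"
  "open_neighborhood T' u3 = {u2, u4, v}" "open_neighborhood T' u4 = {u3, u5}"
  "open_neighborhood T' u5 = {u4, u6}" "open_neighborhood T' u6 = {u5}"
  using arcs v fresh dist by (auto simp: open_neighborhood_def T' parcs_path6)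

end

lemma neighborhood_path6:
  assumes "distinct [u1, u2, u3, u4, u5, u6]"
  defines "P \<equiv> path_graph [u1, u2, u3, u4, u5, u6]"
  shows "open_neighborhood P u1 = {u2}" "open_neighborhood P u2 = {u1, u3}"
    "open_neighborhood P u3 = {u2, u4}" "open_neighborhood P u4 = {u3, u5}"
    "open_neighborhood P u5 = {u4, u6}" "open_neighborhood P u6 = {u5}"
    "pverts P = {u1, u2, u3, u4, u5, u6}"
proof -
  show P: "pverts P = {u1, u2, u3, u4, u5, u6}" by (simp add: P_def path_graph_def)
  show "open_neighborhood P u1 = {u2}" "open_neighborhood P u2 = {u1, u3}"
    "open_neighborhood P u3 = {u2, u4}" "open_neighborhood P u4 = {u3, u5}"
    "open_neighborhood P u5 = {u4, u6}" "open_neighborhood P u6 = {u5}"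
    unfolding open_neighborhood_def P unfolding P_def parcs_path6 using assms(1) by auto
qed

text \<open>The last four hypotheses say what dominating \<open>u1\<close>, \<open>u6\<close>,
  \<open>u2\<close> and \<open>u5\<close> from within the path amounts to: the end vertices force
  \<open>u2\<close> and \<open>u5\<close>, and these two force one further vertex each.\<close>

lemma path6_hit:
  assumes "distinct [u1, u2, u3, u4, u5, u6]" "finite D" "D \<subseteq> {u1, u2, u3, u4, u5, u6}"
    and "u2 \<in> D" "u5 \<in> D" "u1 \<in> D \<or> u3 \<in> D" "u4 \<in> D \<or> u6 \<in> D"
  shows "4 \<le> card D"
proof -
  obtain x y where xy: "x \<in> D" "x \<in> {u1, u3}" "y \<in> D" "y \<in> {u4, u6}" using assms by blast
  have "card {u2, u5, x, y} = 4" using assms(1) xy by auto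
  moreover have "{u2, u5, x, y} \<subseteq> D" using assms xy by auto
  ultimately show ?thesis using card_mono[OF assms(2)] by metis
qed

text \<open>Demanding domination of the vertices of status A and C only makes the bound inductive,
  since attaching a path changes the neighbourhood of a vertex of status B.\<close>

lemma labeled_tree_family_dominating_bound:
  assumes "(T, (SA, SB, SC)) \<in> labeled_tree_family"
    and "D \<subseteq> pverts T" and "\<And>x. x \<in> SA \<union> SC \<Longrightarrow> open_neighborhood T x \<inter> D \<noteq> {}"
  shows "2 * card (pverts T) \<le> 3 * card D"
  using assms
proof (induction T SA SB SC arbitrary: D rule: labeled_tree_family.induct)
  case (path6 u1 u2 u3 u4 u5 u6)
  note N = neighborhood_path6[OF path6(1)]
  have "4 \<le> card D"
    using path6(2) path6(3)[of u1] path6(3)[of u2] path6(3)[of u5] path6(3)[of u6]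
    by (intro path6_hit[OF path6(1)]) (auto simp: N finite_subset)
  moreover have "card {u1, u2, u3, u4, u5, u6} = 6" using path6(1) by simp
  ultimately show ?case by (simp add: N)
next
  case (attach T SA SB SC v u1 u2 u3 u4 u5 u6)
  let ?B = "{u1, u2, u3, u4, u5, u6}"
  let ?T = "\<lparr>pverts = pverts T \<union> ?B,
        parcs = parcs T \<union> parcs (path_graph [u1, u2, u3, u4, u5, u6]) \<union> {(u3, v), (v, u3)}\<rparr>"
  note wf = labeled_tree_family_wf[OF attach.hyps(1)]
  interpret path_attachment T ?T v u1 u2 u3 u4 u5 u6
    using wf attach.hyps by unfold_locales auto
  have D: "D \<subseteq> pverts T \<union> ?B" using attach.prems(1) by simp
  have finD: "finite D" using D wf finite_subset by blast
  have "2 * card (pverts T) \<le> 3 * card (D \<inter> pverts T)"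
  proof (rule attach.IH)
    fix x assume x: "x \<in> SA \<union> SC"
    \<comment> \<open>The attachment vertex \<open>v\<close> has status B, so the neighbourhood of
      \<open>x\<close> is the same before and after the attachment.\<close>
    hence "x \<in> pverts T" "x \<noteq> v" using wf attach.hyps(2) by auto
    moreover have "open_neighborhood ?T x \<inter> D \<noteq> {}" using attach.prems(2)[of x] x by blast
    ultimately show "open_neighborhood T x \<inter> (D \<inter> pverts T) \<noteq> {}"
      using neighborhood_old[of x] by (auto simp: open_neighborhood_def)
  qed simp
  moreover have "4 \<le> card (D \<inter> ?B)"
  proof (rule path6_hit[OF attach.hyps(3)])
    have "open_neighborhood ?T x \<inter> D \<noteq> {}" if "x \<in> {u1, u2, u5, u6}" for x
      using attach.prems(2)[of x] that by blast
    from this[of u1] this[of u2] this[of u5] this[of u6]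
    show "u2 \<in> D \<inter> ?B" "u5 \<in> D \<inter> ?B" "u1 \<in> D \<inter> ?B \<or> u3 \<in> D \<inter> ?B" "u4 \<in> D \<inter> ?B \<or> u6 \<in> D \<inter> ?B"
      unfolding neighborhood_new by auto
  qed (use finD in auto)
  moreover have "card D = card (D \<inter> pverts T) + card (D \<inter> ?B)"
  proof -
    have "D = (D \<inter> pverts T) \<union> (D \<inter> ?B)" using D by blast
    moreover have "card ((D \<inter> pverts T) \<union> (D \<inter> ?B)) = card (D \<inter> pverts T) + card (D \<inter> ?B)"
      using finD fresh by (intro card_Un_disjoint) auto
    ultimately show ?thesis by simp
  qed
  moreover have "card (pverts T \<union> ?B) = card (pverts T) + card ?B"
    using wf fresh by (intro card_Un_disjoint) auto
  moreover have "card ?B = 6" using dist by simp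
  ultimately show ?case by simp
qed

text \<open>In a 6-vertex path the edges between \<open>{u2, u3, u6}\<close> and its complement
  \<open>{u1, u4, u5}\<close> are exactly \<open>u1u2\<close>, \<open>u3u4\<close> and
  \<open>u5u6\<close>, a perfect matching, so either side is super dominating. Each attachment can
  thus use the side that keeps the edge from \<open>u3\<close> to \<open>v\<close> from joining the
  set to its complement.\<close>

lemma labeled_tree_family_super_dominating:
  assumes "(T, (SA, SB, SC)) \<in> labeled_tree_family"
  shows "\<exists>S. super_dominating_set T S \<and> 2 * card S = card (pverts T)"
  using assms
proof (induction T SA SB SC rule: labeled_tree_family.induct)
  case (path6 u1 u2 u3 u4 u5 u6)
  note N = neighborhood_path6[OF path6(1)]
  have S: "pverts (path_graph [u1, u2, u3, u4, u5, u6]) - {u2, u3, u6} = {u1, u4, u5}"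
    unfolding N using path6(1) by auto
  have "super_dominating_set (path_graph [u1, u2, u3, u4, u5, u6]) {u2, u3, u6}"
    unfolding super_dominating_set_def S using path6(1) by (auto simp: N)
  moreover have "2 * card {u2, u3, u6} = card {u1, u2, u3, u4, u5, u6}" using path6(1) by simp
  ultimately show ?case unfolding N by blast
next
  case (attach T SA SB SC v u1 u2 u3 u4 u5 u6)
  let ?B = "{u1, u2, u3, u4, u5, u6}"
  let ?T = "\<lparr>pverts = pverts T \<union> ?B,
        parcs = parcs T \<union> parcs (path_graph [u1, u2, u3, u4, u5, u6]) \<union> {(u3, v), (v, u3)}\<rparr>"
  note wf = labeled_tree_family_wf[OF attach.hyps(1)]
  interpret path_attachment T ?T v u1 u2 u3 u4 u5 u6
    using wf attach.hyps by unfold_locales auto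
  obtain S where S: "super_dominating_set T S" "2 * card S = card (pverts T)" using attach.IH by blast
  have sub: "S \<subseteq> pverts T" using S by (simp add: super_dominating_set_def)
  text \<open>The vertex \<open>u3\<close> has to be on the same side as \<open>v\<close>.\<close>
  define B1 where "B1 = (if v \<in> S then {u2, u3, u6} else {u1, u4, u5})"
  define B2 where "B2 = (if v \<in> S then {u1, u4, u5} else {u2, u3, u6})"
  have B: "?B = B1 \<union> B2" "B1 \<inter> B2 = {}" "card B1 = 3" "finite B1" "B1 \<inter> S = {}" "card ?B = 6"
    using dist fresh sub by (auto simp: B1_def B2_def)
  have compl: "pverts ?T - (S \<union> B1) = (pverts T - S) \<union> B2"
    using B fresh sub by auto
  have "super_dominating_set ?T (S \<union> B1)"
    unfolding super_dominating_set_def compl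
  proof (intro conjI ballI)
    show "S \<union> B1 \<subseteq> pverts ?T" using sub B by auto
    fix u assume "u \<in> (pverts T - S) \<union> B2"
    then consider "u \<in> pverts T - S" | "u \<in> B2" by blast
    thus "\<exists>x\<in>S \<union> B1. open_neighborhood ?T x \<inter> ((pverts T - S) \<union> B2) = {u}"
    proof cases
      case 1
      then obtain x where x: "x \<in> S" "open_neighborhood T x \<inter> (pverts T - S) = {u}"
        using S(1) unfolding super_dominating_set_def by blast
      have "open_neighborhood ?T x \<inter> ((pverts T - S) \<union> B2) = open_neighborhood T x \<inter> (pverts T - S)"
      proof -
        have "open_neighborhood T x \<inter> B2 = {}" using fresh B(1) by (auto simp: open_neighborhood_def)
        \<comment> \<open>If \<open>x = v\<close> then \<open>v\<close> is in \<open>S\<close>, so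
          the new neighbour \<open>u3\<close> is in the set as well and \<open>x\<close> keeps its
          private neighbour.\<close>
        moreover have "(if x = v then {u3} else {}) \<inter> ((pverts T - S) \<union> B2) = {}"
          using x(1) fresh dist by (auto simp: B2_def)
        moreover have "x \<in> pverts T" using x(1) sub by blast
        ultimately show ?thesis unfolding neighborhood_old[OF \<open>x \<in> pverts T\<close>] by blast
      qed
      thus ?thesis using x by blast
    next
      case 2
      show ?thesis
      proof (cases "v \<in> S")
        case True
        have b: "B1 = {u2, u3, u6}" "B2 = {u1, u4, u5}" using True by (simp_all add: B1_def B2_def)
        have "open_neighborhood ?T u2 \<inter> ((pverts T - S) \<union> B2) = {u1}"
          "open_neighborhood ?T u3 \<inter> ((pverts T - S) \<union> B2) = {u4}"
          "open_neighborhood ?T u6 \<inter> ((pverts T - S) \<union> B2) = {u5}"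
          unfolding neighborhood_new b using dist fresh True v by auto
        thus ?thesis using 2 b by auto
      next
        case False
        have b: "B1 = {u1, u4, u5}" "B2 = {u2, u3, u6}" using False by (simp_all add: B1_def B2_def)
        have "open_neighborhood ?T u1 \<inter> ((pverts T - S) \<union> B2) = {u2}"
          "open_neighborhood ?T u4 \<inter> ((pverts T - S) \<union> B2) = {u3}"
          "open_neighborhood ?T u5 \<inter> ((pverts T - S) \<union> B2) = {u6}"
          unfolding neighborhood_new b using dist fresh by auto
        thus ?thesis using 2 b by auto
      qed
    qed
  qed
  moreover have "card (S \<union> B1) = card S + card B1"
    using B sub wf by (intro card_Un_disjoint) (auto intro: finite_subset)
  moreover have "card (pverts T \<union> ?B) = card (pverts T) + card ?B"
    using wf fresh by (intro card_Un_disjoint) auto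
  ultimately show ?case using S(2) B by (intro exI[of _ "S \<union> B1"]) simp
qed

section \<open>The ratio bound and its equality case\<close>

theorem theorem2p6:
  fixes T :: "'a pair_pre_digraph"
  assumes "undirected_tree T" and "3 \<le> card (pverts T)"
  shows "0 < real (total_domination_number T) / real (super_domination_number T) \<and>
         real (total_domination_number T) / real (super_domination_number T) \<le> 4 / 3 \<and>
         (real (total_domination_number T) / real (super_domination_number T) = 4 / 3 \<longleftrightarrow>
            (\<exists>S. is_labeling T S \<and> (T, S) \<in> labeled_tree_family))"
proof -
  let ?n = "card (pverts T)" and ?t = "total_domination_number T" and ?s = "super_domination_number T"
  obtain r par lev w l where "well_rooted_tree T r par lev w l"
    using undirected_tree_well_rooting[OF assms] .
  then interpret well_rooted_tree T r par lev w l .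
  obtain D where D: "total_dominating_set T D" "card D = ?t"
    using total_domination_number_attained[OF total_dominating_level_dom] .
  obtain S where S: "super_dominating_set T S" "card S = ?s"
    by (rule super_domination_number_attained)
  have upper: "3 * ?t \<le> 2 * ?n" by (rule total_domination_number_bound)
  have lower: "?n \<le> 2 * ?s" using card_le_super_dominating[OF S(1) finite_verts] S(2) by simp
  have "D \<noteq> {}" "finite D" using D(1) root finite_verts finite_subset
    by (auto simp: total_dominating_set_def)
  hence t_pos: "0 < ?t" using D(2) by (metis card_gt_0_iff)
  have s_pos: "0 < ?s" using lower assms(2) by linarith
  \<comment> \<open>The bounds form a chain \<open>3t \<le> 2n \<le> 4s\<close>, so the ratio is 4/3
    exactly when both are equalities.\<close>
  have ratio: "real ?t / real ?s = 4 / 3 \<longleftrightarrow> 3 * ?t = 2 * ?n \<and> ?n = 2 * ?s"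
  proof -
    have "real ?t / real ?s = 4 / 3 \<longleftrightarrow> real (3 * ?t) = real (4 * ?s)"
      using s_pos by (simp add: field_simps)
    also have "\<dots> \<longleftrightarrow> 3 * ?t = 4 * ?s" by (rule of_nat_eq_iff)
    also have "\<dots> \<longleftrightarrow> 3 * ?t = 2 * ?n \<and> ?n = 2 * ?s" using upper lower by linarith
    finally show ?thesis .
  qed
  have "3 * ?t \<le> 4 * ?s" using upper lower by linarith
  hence "real (3 * ?t) \<le> real (4 * ?s)" by (rule of_nat_mono)
  hence bound: "real ?t / real ?s \<le> 4 / 3" using s_pos by (simp add: field_simps)
  have "3 * ?t = 2 * ?n \<and> ?n = 2 * ?s \<longleftrightarrow> (\<exists>S. is_labeling T S \<and> (T, S) \<in> labeled_tree_family)"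
  proof
    assume "3 * ?t = 2 * ?n \<and> ?n = 2 * ?s"
    then interpret extremal_super_tree T r par lev w l S
      using S by unfold_locales auto
    show "\<exists>S. is_labeling T S \<and> (T, S) \<in> labeled_tree_family"
      using is_labeling in_labeled_tree_family by blast
  next
    assume "\<exists>S. is_labeling T S \<and> (T, S) \<in> labeled_tree_family"
    then obtain SA SB SC where fam: "(T, (SA, SB, SC)) \<in> labeled_tree_family" by (metis prod_cases3)
    \<comment> \<open>For a member of the family both bounds reverse: a minimum total dominating set
      \<open>D\<close> in particular dominates the vertices of status A and C, and a super
      dominating set of size \<open>n/2\<close> exists.\<close>
    have "2 * ?n \<le> 3 * card D"
    proof (rule labeled_tree_family_dominating_bound[OF fam])
      show "D \<subseteq> pverts T" using D(1) by (simp add: total_dominating_set_def)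
      show "open_neighborhood T x \<inter> D \<noteq> {}" if "x \<in> SA \<union> SC" for x
        using D(1) that labeled_tree_family_wf[OF fam] by (auto simp: total_dominating_set_def)
    qed
    moreover obtain S' where "super_dominating_set T S'" "2 * card S' = ?n"
      using labeled_tree_family_super_dominating[OF fam] by blast
    hence "2 * ?s \<le> ?n" using super_domination_number_le by fastforce
    ultimately show "3 * ?t = 2 * ?n \<and> ?n = 2 * ?s" using D(2) upper lower by linarith
  qed
  thus ?thesis using ratio bound t_pos s_pos by simp
qed

end
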